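(* Let $G$ be a finite simple graph on $n$ vertices with independence number $\alpha(G)=2$. If $G$ contains neither supercycles nor incompatible double tops, then $ecc(G)\leq \frac{3}{2}n$.
   Context: The edge clique cover number $ecc(G)$ is the minimum number of cliques of $G$ such that both endpoints of every edge of $G$ lie together in at least one of these cliques. An edge $uv$ is dominating if every vertex of $G$ other than $u,v$ is adjacent to at least one of $u,v$. A double top is a path $x_0x_1x_2x_3x_4$ (distinct vertices) whose four edges $x_0x_1,x_1x_2,x_2x_3,x_3x_4$ are all dominating edges and such that $x_2$ is adjacent neither to $x_0$ nor to $x_4$. A double top $x_0x_1x_2x_3x_4$ is incompatible if $x_1x_3$ is not an edge of $G$. A supercycle is a cycle $u_0u_1\cdots u_k$ with $k\in\{3,\dots,n-1\}$, all of whose edges are dominating edges, such that for every $i\in\{0,\dots,k\}$, $u_{i-1}u_{i+1}$ is an edge of $G$ (indices taken modulo $k+1$). *)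

theory Defs
  imports Complex_Main "HOL-Library.Ramsey"
begin

text \<open>
  A simple graph is given by its vertex set \<open>V\<close> and its edge set \<open>E \<subseteq> [V]\<^bsup>2\<^esup>\<close>, so edges are
  two-element sets of vertices. Cliques and independent sets are \<open>clique\<close> and \<open>indep\<close> from
  \<^theory>\<open>HOL-Library.Ramsey\<close>.
\<close>

definition independence_number :: "'a set \<Rightarrow> 'a set set \<Rightarrow> nat" where
  "independence_number V E = Max (card ` {S. S \<subseteq> V \<and> indep S E})"

definition edge_clique_cover :: "'a set \<Rightarrow> 'a set set \<Rightarrow> 'a set set \<Rightarrow> bool" where
  "edge_clique_cover V E C \<longleftrightarrow>
     finite C \<and> (\<forall>K\<in>C. K \<subseteq> V \<and> clique K E) \<and> (\<forall>e\<in>E. \<exists>K\<in>C. e \<subseteq> K)"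

definition ecc :: "'a set \<Rightarrow> 'a set set \<Rightarrow> nat" where
  "ecc V E = (LEAST k. \<exists>C. edge_clique_cover V E C \<and> card C = k)"

definition dominating_edge :: "'a set \<Rightarrow> 'a set set \<Rightarrow> 'a \<Rightarrow> 'a \<Rightarrow> bool" where
  "dominating_edge V E u v \<longleftrightarrow>
     {u, v} \<in> E \<and> (\<forall>w \<in> V - {u, v}. {w, u} \<in> E \<or> {w, v} \<in> E)"

definition double_top :: "'a set \<Rightarrow> 'a set set \<Rightarrow> 'a \<Rightarrow> 'a \<Rightarrow> 'a \<Rightarrow> 'a \<Rightarrow> 'a \<Rightarrow> bool" where
  "double_top V E x0 x1 x2 x3 x4 \<longleftrightarrow>
     {x0, x1, x2, x3, x4} \<subseteq> V \<and> distinct [x0, x1, x2, x3, x4] \<and>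
     dominating_edge V E x0 x1 \<and> dominating_edge V E x1 x2 \<and>
     dominating_edge V E x2 x3 \<and> dominating_edge V E x3 x4 \<and>
     {x2, x0} \<notin> E \<and> {x2, x4} \<notin> E"

definition incompatible_double_top ::
    "'a set \<Rightarrow> 'a set set \<Rightarrow> 'a \<Rightarrow> 'a \<Rightarrow> 'a \<Rightarrow> 'a \<Rightarrow> 'a \<Rightarrow> bool" where
  "incompatible_double_top V E x0 x1 x2 x3 x4 \<longleftrightarrow>
     double_top V E x0 x1 x2 x3 x4 \<and> {x1, x3} \<notin> E"

text \<open>
  The cycle \<open>u 0, \<dots>, u k\<close> has \<open>k + 1\<close> vertices. On the natural numbers the predecessor of the
  index \<open>i\<close> modulo \<open>k + 1\<close> is \<open>(i + k) mod (k + 1)\<close>.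
\<close>

definition supercycle :: "'a set \<Rightarrow> 'a set set \<Rightarrow> nat \<Rightarrow> (nat \<Rightarrow> 'a) \<Rightarrow> bool" where
  "supercycle V E k u \<longleftrightarrow>
     k \<in> {3..card V - 1} \<and> u ` {0..k} \<subseteq> V \<and> inj_on u {0..k} \<and>
     (\<forall>i\<in>{0..k}. dominating_edge V E (u i) (u ((i + 1) mod (k + 1)))) \<and>
     (\<forall>i\<in>{0..k}. {u ((i + k) mod (k + 1)), u ((i + 1) mod (k + 1))} \<in> E)"

text \<open>The minimum in the definition of \<open>ecc\<close> is attained.\<close>

lemma ex_edge_clique_cover:
  assumes "finite V" and "E \<subseteq> [V]\<^bsup>2\<^esup>"
  shows "\<exists>C. edge_clique_cover V E C \<and> card C = ecc V E"
proof -
  have "finite E"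
    using assms finite_imp_finite_nsets finite_subset by blast
  moreover have "e \<subseteq> V \<and> clique e E" if "e \<in> E" for e
  proof -
    from that assms have "e \<in> [V]\<^bsup>2\<^esup>" by blast
    then obtain x y where "e = {x, y}" "x \<in> V" "y \<in> V"
      by (auto simp: nsets_2_eq)
    with that show ?thesis by (auto simp: clique_def insert_commute)
  qed
  ultimately have "edge_clique_cover V E E"
    by (auto simp: edge_clique_cover_def)
  then have "\<exists>k C. edge_clique_cover V E C \<and> card C = k" by blast
  then show ?thesis unfolding ecc_def by (rule LeastI_ex)
qed

end

theory Submission
  imports Defs
begin

text \<open>
  For a vertex \<open>x\<close> let \<open>M x\<close> be the set of its non-neighbours, a clique because \<open>\<alpha> = 2\<close>. An edge
  that is not dominating lies in some \<open>M x\<close>. If \<open>x v\<close> is dominating then \<open>v\<close> is adjacent to all of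
  \<open>M x\<close>; so if \<open>x v u\<close> is a path of dominating edges with \<open>u \<in> M x\<close>, the edge \<open>v u\<close> gets covered by
  adding \<open>v\<close> to \<open>M x\<close>. Two such additions \<open>v, v'\<close> at \<open>x\<close> are adjacent unless they come from an induced
  4-cycle \<open>x v u v'\<close> of dominating edges, since otherwise there is an incompatible double top. For the
  same reason these 4-cycles are edge-disjoint, so each can be oriented independently, and \<open>x\<close> takes
  only its successor on each cycle; this still covers all four edges. This uses \<open>n\<close> cliques.

  The remaining (tight) dominating edges are those where every path of two dominating edges
  through them closes up to a triangle of \<open>G\<close>. The closed neighbourhoods in the graph of tight edges
  are therefore cliques, and a cycle of length at least 4 of tight edges is a supercycle. A graph
  whose cycles are all triangles has a 2-colouring of the vertices in which each monochromatic edge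
  has a common neighbour of the other colour, so the closed neighbourhoods around the smaller colour
  class cover it; this uses at most \<open>n / 2\<close> cliques.
\<close>

section \<open>Two-colouring a graph without cycles of length at least four\<close>

definition rel_cycle :: "('a \<Rightarrow> 'a \<Rightarrow> bool) \<Rightarrow> 'a list \<Rightarrow> bool" where
  "rel_cycle F xs \<longleftrightarrow> distinct xs \<and> successively F xs \<and> xs \<noteq> [] \<and> F (last xs) (hd xs)"

text \<open>The first vertex of a longest path has all its neighbours among the next two vertices.\<close>

lemma ex_small_neighbourhood:
  assumes "finite S" "S \<noteq> {}"
    and sym: "\<And>u v. F u v \<Longrightarrow> F v u" and irrefl: "\<And>u. \<not> F u u"
    and no_cycle: "\<And>xs. rel_cycle F xs \<Longrightarrow> set xs \<subseteq> S \<Longrightarrow> length xs < 4"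
  shows "\<exists>v\<in>S. (\<exists>a. {w \<in> S. F v w} \<subseteq> {a}) \<or> (\<exists>a b. {w \<in> S. F v w} = {a, b} \<and> F a b)"
proof -
  let ?P = "\<lambda>xs. distinct xs \<and> set xs \<subseteq> S \<and> successively F xs \<and> xs \<noteq> []"
  obtain x where "x \<in> S" using assms by blast
  then have "?P [x]" by simp
  moreover have "\<forall>xs. ?P xs \<longrightarrow> length xs < Suc (card S)"
    by (metis assms(1) card_mono distinct_card less_Suc_eq_le)
  ultimately obtain xs where P: "?P xs" and max: "\<And>ys. ?P ys \<Longrightarrow> length ys \<le> length xs"
    using ex_has_greatest_nat[of ?P "[x]" length "Suc (card S)"] by blast
  then obtain v ys where xs: "xs = v # ys" by (cases xs) auto
  have v: "v \<in> S" using P xs by simp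
  have idx: "\<exists>j\<in>{1, 2}. j < length xs \<and> w = xs ! j" if "w \<in> S" "F v w" for w
  proof -
    have "w \<in> set xs"
    proof (rule ccontr)
      assume "w \<notin> set xs"
      then have "?P (w # xs)" using P that xs sym by (auto simp: successively_Cons)
      from max[OF this] show False by simp
    qed
    then obtain j where j: "j < length xs" "w = xs ! j" by (metis in_set_conv_nth)
    have "j \<noteq> 0" using j that xs irrefl by (metis nth_Cons_0)
    moreover have "j < 3"
    proof -
      \<comment> \<open>The edge from \<open>w\<close> back to \<open>v\<close> closes this prefix
        of the path into a cycle with \<open>j + 1\<close> vertices.\<close>
      let ?zs = "take (Suc j) xs"
      have "last ?zs = w" using j by (simp add: take_Suc_conv_app_nth)
      moreover have "hd ?zs = v" using xs by simp
      moreover have "distinct ?zs" "?zs \<noteq> []" using P by auto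
      moreover have "successively F ?zs"
        using P by (metis append_take_drop_id successively_append_iff)
      ultimately have "rel_cycle F ?zs"
        unfolding rel_cycle_def using sym[OF that(2)] by simp
      moreover have "set ?zs \<subseteq> S" using P set_take_subset by fast
      ultimately show ?thesis using no_cycle[of ?zs] j by simp
    qed
    ultimately have "j \<in> {1, 2}" by auto
    then show ?thesis using j by blast
  qed
  show ?thesis
  proof (cases "2 < length xs \<and> F v (xs ! 2)")
    case True
    have step: "F (xs ! 0) (xs ! 1)" "F (xs ! 1) (xs ! 2)"
      using P True unfolding successively_conv_nth by (auto simp: numeral_2_eq_2)
    have "{w \<in> S. F v w} = {xs ! 1, xs ! 2}"
    proof
      show "{w \<in> S. F v w} \<subseteq> {xs ! 1, xs ! 2}" using idx by blast
      have "xs ! 1 \<in> set xs" "xs ! 2 \<in> set xs" using True by auto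
      then show "{xs ! 1, xs ! 2} \<subseteq> {w \<in> S. F v w}" using P True step xs by auto
    qed
    then show ?thesis using v step by blast
  next
    case False
    then have "{w \<in> S. F v w} \<subseteq> {xs ! 1}" using idx by blast
    then show ?thesis using v by blast
  qed
qed

text \<open>Induction: delete a vertex \<open>v\<close> with at most one neighbour or with two
  adjacent ones. Colouring \<open>v\<close> against a lone neighbour or an equally coloured pair
  creates no monochromatic edge. If the pair has both colours, \<open>v\<close> may share the colour
  of one neighbour, and the other is the witness.\<close>

lemma ex_colouring:
  assumes "finite S"
    and sym: "\<And>u v. F u v \<Longrightarrow> F v u" and irrefl: "\<And>u. \<not> F u u"
    and no_cycle: "\<And>xs. rel_cycle F xs \<Longrightarrow> set xs \<subseteq> S \<Longrightarrow> length xs < 4"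
  shows "\<exists>c :: 'a \<Rightarrow> bool. \<forall>u\<in>S. \<forall>v\<in>S. F u v \<and> c u = c v \<longrightarrow>
           (\<exists>w\<in>S. F u w \<and> F v w \<and> c w \<noteq> c u)"
  using assms(1) no_cycle
proof (induction "card S" arbitrary: S)
  case 0
  then show ?case by simp
next
  case (Suc n)
  then have "S \<noteq> {}" by auto
  from ex_small_neighbourhood[where F = F, OF Suc.prems(1) this sym irrefl Suc.prems(2)]
  obtain v where v: "v \<in> S" and
    nb: "(\<exists>a. {w \<in> S. F v w} \<subseteq> {a}) \<or> (\<exists>a b. {w \<in> S. F v w} = {a, b} \<and> F a b)"
    by blast
  have "\<exists>c :: 'a \<Rightarrow> bool. \<forall>u\<in>S - {v}. \<forall>w\<in>S - {v}. F u w \<and> c u = c w \<longrightarrow>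
           (\<exists>z\<in>S - {v}. F u z \<and> F w z \<and> c z \<noteq> c u)"
  proof (rule Suc.hyps(1))
    show "n = card (S - {v})" using Suc.hyps(2) Suc.prems(1) v by simp
    show "finite (S - {v})" using Suc.prems(1) by simp
    show "length xs < 4" if "rel_cycle F xs" "set xs \<subseteq> S - {v}" for xs
      using Suc.prems(2)[OF that(1)] that(2) by blast
  qed
  then obtain c :: "'a \<Rightarrow> bool" where
    c_all: "\<forall>u\<in>S - {v}. \<forall>w\<in>S - {v}. F u w \<and> c u = c w \<longrightarrow>
           (\<exists>z\<in>S - {v}. F u z \<and> F w z \<and> c z \<noteq> c u)"
    by (rule exE)
  have c: "\<exists>z\<in>S - {v}. F u z \<and> F w z \<and> c z \<noteq> c u"
    if "u \<in> S - {v}" "w \<in> S - {v}" "F u w" "c u = c w" for u w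
    using that by (intro c_all[rule_format]) auto
  \<comment> \<open>Old edges keep their witnesses, which differ from \<open>v\<close>, so only the
    edges at \<open>v\<close> need checking.\<close>
  have extend: ?case
    if d: "\<And>w. w \<in> S \<Longrightarrow> F v w \<Longrightarrow> d = c w \<Longrightarrow> \<exists>z\<in>S - {v}. F v z \<and> F w z \<and> c z \<noteq> d"
    for d
  proof (intro exI ballI impI)
    fix u w assume uw: "u \<in> S" "w \<in> S" "F u w \<and> (c(v := d)) u = (c(v := d)) w"
    then have "u \<noteq> w" using irrefl by auto
    then consider "u = v" "w \<noteq> v" | "w = v" "u \<noteq> v" | "u \<noteq> v" "w \<noteq> v" by blast
    then have "\<exists>z\<in>S - {v}. F u z \<and> F w z \<and> c z \<noteq> (c(v := d)) u"
    proof cases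
      case 1
      then show ?thesis using d[of w] uw by auto
    next
      case 2
      then show ?thesis using d[of u] uw sym by auto
    next
      case 3
      then show ?thesis using c[of u w] uw by auto
    qed
    then obtain z where "z \<in> S - {v}" "F u z" "F w z" "c z \<noteq> (c(v := d)) u" by blast
    then show "\<exists>z\<in>S. F u z \<and> F w z \<and> (c(v := d)) z \<noteq> (c(v := d)) u"
      by (intro bexI[of _ z]) simp_all
  qed
  from nb show ?case
  proof (elim disjE exE conjE)
    fix a assume "{w \<in> S. F v w} \<subseteq> {a}"
    then show ?case by (intro extend[of "\<not> c a"]) auto
  next
    fix a b assume ab: "{w \<in> S. F v w} = {a, b}" "F a b"
    then have mem: "a \<in> S - {v}" "b \<in> S - {v}" "F v a" "F v b" using irrefl by auto
    have nb_cases: "w = a \<or> w = b" if "w \<in> S" "F v w" for w using ab(1) that by blast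
    show ?case
    proof (cases "c a = c b")
      case True
      show ?thesis
      proof (rule extend[of "\<not> c a"])
        fix w assume "w \<in> S" "F v w" "(\<not> c a) = c w"
        then have False using nb_cases True by metis
        then show "\<exists>z\<in>S - {v}. F v z \<and> F w z \<and> c z \<noteq> (\<not> c a)" by (rule FalseE)
      qed
    next
      case False
      show ?thesis
      proof (rule extend[of "c b"])
        fix w assume "w \<in> S" "F v w" "c b = c w"
        then have "w = b" using nb_cases False by metis
        then show "\<exists>z\<in>S - {v}. F v z \<and> F w z \<and> c z \<noteq> c b"
          using mem sym[OF ab(2)] False by blast
      qed
    qed
  qed
qed

section \<open>Dominating edges and their induced 4-cycles\<close>

locale two_independent_graph =
  fixes V :: "'a set" and E :: "'a set set"
  assumes finite_V: "finite V" and edges: "E \<subseteq> [V]\<^bsup>2\<^esup>"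
    and no_independent_triple:
      "\<And>x y z. x \<in> V \<Longrightarrow> y \<in> V \<Longrightarrow> z \<in> V \<Longrightarrow> distinct [x, y, z] \<Longrightarrow>
         {x, y} \<in> E \<or> {x, z} \<in> E \<or> {y, z} \<in> E"
    and no_supercycle: "\<not> supercycle V E k u"
    and no_incompatible: "\<not> incompatible_double_top V E x0 x1 x2 x3 x4"
begin

abbreviation "dedge \<equiv> dominating_edge V E"

lemma edgeD: "{u, v} \<in> E \<Longrightarrow> u \<in> V \<and> v \<in> V \<and> u \<noteq> v"
  using edges by (auto simp: nsets_2_eq doubleton_eq_iff)

lemma dom_sym: "dedge u v \<longleftrightarrow> dedge v u"
  by (auto simp: dominating_edge_def insert_commute)

lemma domD: "dedge u v \<Longrightarrow> {u, v} \<in> E \<and> {v, u} \<in> E \<and> u \<in> V \<and> v \<in> V \<and> u \<noteq> v"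
  using edgeD[of u v] by (auto simp: dominating_edge_def insert_commute)

definition non_neighbours :: "'a \<Rightarrow> 'a set" where
  "non_neighbours x = {w \<in> V. w \<noteq> x \<and> {w, x} \<notin> E}"

lemma non_neighbours_sym: "x \<in> V \<Longrightarrow> u \<in> non_neighbours x \<Longrightarrow> x \<in> non_neighbours u"
  by (auto simp: non_neighbours_def insert_commute)

text \<open>Otherwise \<open>u v x v' u'\<close> is an incompatible double top: \<open>u\<close> and
  \<open>u'\<close> differ from \<open>v\<close> and \<open>v'\<close>, since they miss
  \<open>x\<close> while \<open>v\<close> and \<open>v'\<close> are adjacent to it.\<close>

lemma double_top_ends_eq:
  assumes "dedge u v" "dedge v x" "dedge x v'" "dedge v' u'"
    and "u \<in> non_neighbours x" "u' \<in> non_neighbours x"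
    and "v' \<in> non_neighbours v"
  shows "u = u'"
proof (rule ccontr)
  assume "u \<noteq> u'"
  then have "incompatible_double_top V E u v x v' u'"
    unfolding incompatible_double_top_def double_top_def
    using assms domD[OF assms(1)] domD[OF assms(2)] domD[OF assms(3)] domD[OF assms(4)]
    by (auto simp: non_neighbours_def insert_commute)
  then show False using no_incompatible by blast
qed

definition dom_square :: "'a \<Rightarrow> 'a \<Rightarrow> 'a \<Rightarrow> 'a \<Rightarrow> bool" where
  "dom_square a b c d \<longleftrightarrow> dedge a b \<and> dedge b c \<and> dedge c d \<and> dedge d a \<and>
     c \<in> non_neighbours a \<and> d \<in> non_neighbours b"

lemma dom_square_rotate: "dom_square a b c d \<Longrightarrow> dom_square b c d a"
  unfolding dom_square_def using domD non_neighbours_sym by blast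

lemma dom_square_flip: "dom_square a b c d \<Longrightarrow> dom_square b a d c"
  unfolding dom_square_def using dom_sym domD non_neighbours_sym by blast

text \<open>The path \<open>c' b a d c\<close> is centred at \<open>a\<close> and its second and
  fourth vertices are nonadjacent, so its ends coincide. Flipping both squares gives the same for
  \<open>d\<close>.\<close>

lemma dom_square_unique:
  assumes "dom_square a b c d" "dom_square a b c' d'"
  shows "c' = c \<and> d' = d"
proof -
  have third: "c = c'" if "dom_square a b c d" "dom_square a b c' d'" for a b c d c' d'
  proof (rule sym, rule double_top_ends_eq)
    show "dedge c' b" "dedge b a" "dedge a d" "dedge d c"
      using that by (auto simp: dom_square_def dom_sym)
  qed (use that in \<open>auto simp: dom_square_def\<close>)
  show ?thesis
    using third[OF assms] third[OF assms[THEN dom_square_flip]] by simp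
qed

section \<open>Orienting the dominating 4-cycles\<close>

definition arcs :: "'a \<Rightarrow> 'a \<Rightarrow> 'a \<Rightarrow> 'a \<Rightarrow> ('a \<times> 'a) set" where
  "arcs a b c d = {(a, b), (b, c), (c, d), (d, a)}"

lemma arcs_start:
  assumes "dom_square a b c d" "(p, q) \<in> arcs a b c d"
  shows "\<exists>r s. dom_square p q r s \<and> arcs a b c d = arcs p q r s"
proof -
  have sq: "dom_square b c d a" "dom_square c d a b" "dom_square d a b c"
    using assms(1) dom_square_rotate by blast+
  have eq: "arcs a b c d = arcs b c d a" "arcs a b c d = arcs c d a b" "arcs a b c d = arcs d a b c"
    by (auto simp: arcs_def)
  from assms(2) consider "p = a" "q = b" | "p = b" "q = c" | "p = c" "q = d" | "p = d" "q = a"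
    by (auto simp: arcs_def)
  then show ?thesis using assms(1) sq eq by cases blast+
qed

lemma arcs_converse: "(arcs a b c d)\<inverse> = arcs b a d c"
  by (auto simp: arcs_def)

lemma arcs_not_symmetric: "dom_square a b c d \<Longrightarrow> (b, a) \<notin> arcs a b c d"
  by (auto simp: arcs_def dom_square_def non_neighbours_def dest: domD)

text \<open>The choice is made from the unordered pair of a cycle and its reversal, so both
  directions of traversal give the same answer.\<close>

definition chosen :: "('a \<times> 'a) set \<Rightarrow> ('a \<times> 'a) set" where
  "chosen S = (SOME T. T \<in> {S, S\<inverse>})"

lemma chosen_cases: "chosen S = S \<or> chosen S = S\<inverse>"
  unfolding chosen_def using someI[of "\<lambda>T. T \<in> {S, S\<inverse>}" S] by simp

lemma chosen_converse: "chosen (S\<inverse>) = chosen S"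
  by (simp add: chosen_def insert_commute)

definition orientation :: "('a \<times> 'a) set" where
  "orientation = \<Union>{arcs a b c d | a b c d. dom_square a b c d \<and> chosen (arcs a b c d) = arcs a b c d}"

lemma arcs_subset_orientation:
  "dom_square a b c d \<Longrightarrow> chosen (arcs a b c d) = arcs a b c d \<Longrightarrow> arcs a b c d \<subseteq> orientation"
  unfolding orientation_def by (rule Union_upper) blast

lemma orientationD:
  assumes "(p, q) \<in> orientation"
  obtains r s where "dom_square p q r s" "chosen (arcs p q r s) = arcs p q r s"
    "arcs p q r s \<subseteq> orientation"
proof -
  from assms obtain a b c d where *: "(p, q) \<in> arcs a b c d" "dom_square a b c d"
    "chosen (arcs a b c d) = arcs a b c d"
    by (auto simp: orientation_def)
  then obtain r s where "dom_square p q r s" "arcs a b c d = arcs p q r s"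
    using arcs_start by blast
  with * that show ?thesis using arcs_subset_orientation by metis
qed

text \<open>Opposite arcs would come from squares on the same edge, hence from one square traversed
  both ways, and only one of the two traversals is chosen.\<close>

lemma orientation_asym:
  assumes "(p, q) \<in> orientation"
  shows "(q, p) \<notin> orientation"
proof
  assume "(q, p) \<in> orientation"
  with assms obtain r s r' s' where
    sq: "dom_square p q r s" "chosen (arcs p q r s) = arcs p q r s" and
    sq': "dom_square q p r' s'" "chosen (arcs q p r' s') = arcs q p r' s'"
    by (meson orientationD)
  have "r' = s \<and> s' = r"
    using dom_square_unique[OF dom_square_flip[OF sq(1)] sq'(1)] .
  then have "arcs p q r s = arcs q p r' s'"
    using sq(2) sq'(2) arcs_converse chosen_converse by metis
  then show False using arcs_not_symmetric[OF sq(1)] by (auto simp: arcs_def)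
qed

lemma orientation_total:
  assumes "dom_square a b c d"
  shows "arcs a b c d \<subseteq> orientation \<or> arcs b a d c \<subseteq> orientation"
  using chosen_cases[of "arcs a b c d"]
proof
  assume "chosen (arcs a b c d) = arcs a b c d"
  then show ?thesis using assms arcs_subset_orientation by blast
next
  assume "chosen (arcs a b c d) = (arcs a b c d)\<inverse>"
  then have "chosen (arcs b a d c) = arcs b a d c"
    by (metis arcs_converse chosen_converse)
  then show ?thesis using dom_square_flip[OF assms] arcs_subset_orientation by blast
qed

section \<open>Cliques covering the edges that are not tight\<close>

text \<open>The vertices to be added to the clique \<open>non_neighbours x\<close>; the last
  condition drops the predecessor of \<open>x\<close> on each oriented square.\<close>

definition tops :: "'a \<Rightarrow> 'a set" where
  "tops x = {v. dedge x v \<and> (\<exists>u \<in> non_neighbours x. dedge v u) \<and> (v, x) \<notin> orientation}"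

text \<open>Nonadjacent \<open>v\<close> and \<open>v'\<close> would share the same \<open>u\<close>
  and so be the two neighbours of \<open>x\<close> on a square; one of them precedes
  \<open>x\<close> in the orientation and is not in \<open>tops x\<close>.\<close>

lemma clique_tops:
  assumes "v \<in> tops x" "v' \<in> tops x" "v \<noteq> v'"
  shows "{v, v'} \<in> E"
proof (rule ccontr)
  assume non: "{v, v'} \<notin> E"
  from assms obtain u u' where u: "u \<in> non_neighbours x" "dedge v u" "dedge x v"
    and u': "u' \<in> non_neighbours x" "dedge v' u'" "dedge x v'"
    by (auto simp: tops_def)
  have v': "v' \<in> non_neighbours v"
    using non assms(3) domD[OF u'(3)] by (simp add: non_neighbours_def insert_commute)
  have "u = u'"
    using double_top_ends_eq[of u v x v' u'] u u' v' dom_sym by blast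
  then have "dom_square x v u v'"
    using u u' v' dom_sym by (auto simp: dom_square_def)
  from orientation_total[OF this] show False
    using assms by (auto simp: arcs_def tops_def)
qed

lemma clique_non_neighbours_tops: "clique (non_neighbours x \<union> tops x) E" if "x \<in> V"
proof -
  have nn: "{u, v} \<in> E" if "u \<in> non_neighbours x" "v \<in> non_neighbours x" "u \<noteq> v" for u v
    using no_independent_triple[of x u v] that \<open>x \<in> V\<close>
    by (auto simp: non_neighbours_def insert_commute)
  have nt: "{u, v} \<in> E" "{v, u} \<in> E" if "u \<in> non_neighbours x" "v \<in> tops x" for u v
    using that by (auto simp: non_neighbours_def tops_def dominating_edge_def insert_commute)
  show ?thesis
    using nn nt clique_tops by (auto simp: clique_def)
qed

lemma path_edge_covered:
  assumes "dedge x v" "dedge v u" "u \<in> non_neighbours x"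
  shows "\<exists>y\<in>V. {u, v} \<subseteq> non_neighbours y \<union> tops y"
proof (cases "(v, x) \<in> orientation")
  case False
  then have "v \<in> tops x" using assms by (auto simp: tops_def)
  then show ?thesis using assms domD by blast
next
  case True
  \<comment> \<open>Here \<open>v\<close> was dropped at \<open>x\<close>. The edge
    \<open>v u\<close> lies on the same square and is covered at \<open>w\<close>, the vertex
    opposite \<open>v\<close>, because \<open>u = z\<close> is the successor of
    \<open>w\<close>.\<close>
  then obtain w z where sq: "dom_square v x w z" and sub: "arcs v x w z \<subseteq> orientation"
    by (rule orientationD)
  have "u = z"
  proof (rule double_top_ends_eq)
    show "dedge u v" "dedge v x" "dedge x w" "dedge w z"
      using assms sq by (auto simp: dom_square_def dom_sym)
  qed (use assms sq in \<open>auto simp: dom_square_def\<close>)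
  moreover have "(z, w) \<notin> orientation"
    using sub by (intro orientation_asym) (auto simp: arcs_def)
  moreover have "w \<in> V" "v \<in> non_neighbours w" "dedge w z" "dedge z v"
    using sq domD non_neighbours_sym unfolding dom_square_def by blast+
  ultimately have "u \<in> tops w" "v \<in> non_neighbours w" "w \<in> V"
    by (auto simp: tops_def)
  then show ?thesis by blast
qed

section \<open>Tight edges and their cycles\<close>

text \<open>These are the dominating edges to which \<open>path_edge_covered\<close> applies in
  neither direction.\<close>

definition tight :: "'a \<Rightarrow> 'a \<Rightarrow> bool" where
  "tight u v \<longleftrightarrow> dedge u v \<and> (\<forall>x. dedge x v \<longrightarrow> x \<notin> non_neighbours u) \<and>
     (\<forall>x. dedge x u \<longrightarrow> x \<notin> non_neighbours v)"

lemma tight_sym: "tight u v \<Longrightarrow> tight v u"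
  by (auto simp: tight_def dom_sym)

lemma tight_closes: "tight u v \<Longrightarrow> tight v w \<Longrightarrow> u \<noteq> w \<Longrightarrow> {u, w} \<in> E"
  by (auto simp: tight_def non_neighbours_def dom_sym insert_commute dest: domD)

lemma edge_covered:
  assumes "{u, v} \<in> E" "\<not> tight u v"
  shows "\<exists>y\<in>V. {u, v} \<subseteq> non_neighbours y \<union> tops y"
proof (cases "dedge u v")
  case False
  then obtain w where "w \<in> V" "u \<noteq> w" "v \<noteq> w" "{w, u} \<notin> E" "{w, v} \<notin> E"
    using assms(1) by (auto simp: dominating_edge_def)
  then show ?thesis
    using edgeD[OF assms(1)] by (auto simp: non_neighbours_def insert_commute)
next
  case True
  then obtain x where "dedge x v \<and> x \<in> non_neighbours u \<or> dedge x u \<and> x \<in> non_neighbours v"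
    using assms(2) by (auto simp: tight_def)
  then show ?thesis
    using path_edge_covered[of x v u] path_edge_covered[of x u v] True dom_sym
      domD[OF True] non_neighbours_sym[of u x] non_neighbours_sym[of v x]
    by (metis insert_commute)
qed

text \<open>The two neighbours of a vertex on the cycle are joined by \<open>tight_closes\<close>,
  so a cycle with at least four vertices would be a supercycle.\<close>

lemma tight_cycle_short:
  assumes cyc: "rel_cycle tight xs" and "set xs \<subseteq> V"
  shows "length xs < 4"
proof (rule ccontr)
  assume len: "\<not> length xs < 4"
  define k where "k = length xs - 1"
  have k: "length xs = Suc k" "3 \<le> k" using len by (auto simp: k_def)
  have dist: "distinct xs" using cyc by (simp add: rel_cycle_def)
  have step: "tight (xs ! i) (xs ! ((i + 1) mod (k + 1)))" if "i \<le> k" for i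
  proof (cases "i = k")
    case True
    have "last xs = xs ! k" "hd xs = xs ! 0"
      using cyc k by (auto simp: rel_cycle_def last_conv_nth hd_conv_nth)
    then show ?thesis using cyc True by (simp add: rel_cycle_def)
  next
    case False
    then show ?thesis
      using cyc that k by (simp add: rel_cycle_def successively_conv_nth)
  qed
  have chord: "{xs ! ((i + k) mod (k + 1)), xs ! ((i + 1) mod (k + 1))} \<in> E" if "i \<le> k" for i
  proof (rule tight_closes)
    have "((i + k) mod (k + 1) + 1) mod (k + 1) = (i + (k + 1)) mod (k + 1)"
      by (metis mod_add_left_eq add.assoc)
    also have "\<dots> = i" using that by (simp only: mod_add_self2) simp
    finally have "((i + k) mod (k + 1) + 1) mod (k + 1) = i" .
    moreover have "(i + k) mod (k + 1) \<le> k"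
      by (simp add: less_Suc_eq_le[symmetric])
    ultimately show "tight (xs ! ((i + k) mod (k + 1))) (xs ! i)"
      using step by metis
    show "tight (xs ! i) (xs ! ((i + 1) mod (k + 1)))" using step that .
    have "(i + k) mod (k + 1) \<noteq> (i + 1) mod (k + 1)"
    proof (cases "i = 0")
      case True
      then show ?thesis using k by simp
    next
      case False
      then have "i + k = (i - 1) + (k + 1)" by simp
      then have "(i + k) mod (k + 1) = (i - 1) mod (k + 1)" by (simp only: mod_add_self2)
      then have "(i + k) mod (k + 1) = i - 1" using that by simp
      moreover have "(i + 1) mod (k + 1) = (if i = k then 0 else i + 1)" using that by simp
      ultimately show ?thesis using False k by (cases "i = k") auto
    qed
    then show "xs ! ((i + k) mod (k + 1)) \<noteq> xs ! ((i + 1) mod (k + 1))"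
      using dist k by (simp add: nth_eq_iff_index_eq)
  qed
  \<comment> \<open>This supplies the upper bound \<open>k \<le> card V - 1\<close> required of a
    supercycle.\<close>
  have "length xs \<le> card V"
    using assms(2) dist finite_V by (metis card_mono distinct_card)
  then have "supercycle V E k ((!) xs)"
    unfolding supercycle_def
    using k step chord assms(2) dist
    by (auto simp: tight_def inj_on_def nth_eq_iff_index_eq less_Suc_eq_le)
  then show False using no_supercycle by blast
qed

section \<open>Covering the tight edges by stars\<close>

definition star :: "'a \<Rightarrow> 'a set" where
  "star s = insert s {v. tight s v}"

lemma clique_star: "clique (star s) E"
proof -
  have "{s, v} \<in> E" "{v, s} \<in> E" if "tight s v" for v
    using that domD by (auto simp: tight_def)
  moreover have "{u, v} \<in> E" if "tight s u" "tight s v" "u \<noteq> v" for u v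
    using tight_closes tight_sym that by blast
  ultimately show ?thesis by (auto simp: star_def clique_def)
qed

lemma ex_star_cover:
  obtains S where "S \<subseteq> V" "2 * card S \<le> card V"
    "\<And>u v. tight u v \<Longrightarrow> \<exists>s\<in>S. {u, v} \<subseteq> star s"
proof -
  have irrefl: "\<not> tight u u" for u
    using domD by (auto simp: tight_def)
  obtain c :: "'a \<Rightarrow> bool" where
    c: "\<And>u v. u \<in> V \<Longrightarrow> v \<in> V \<Longrightarrow> tight u v \<Longrightarrow> c u = c v \<Longrightarrow>
           \<exists>w\<in>V. tight u w \<and> tight v w \<and> c w \<noteq> c u"
    using ex_colouring[where F = tight, OF finite_V tight_sym irrefl tight_cycle_short] by blast
  \<comment> \<open>Each colour class suffices by itself, so the smaller one can be taken. An edge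
    with no end of colour \<open>b\<close> is monochromatic, and its witness has colour
    \<open>b\<close>.\<close>
  have cover: "\<exists>s\<in>{x \<in> V. c x = b}. {u, v} \<subseteq> star s" if uv_tight: "tight u v" for b u v
  proof -
    have uv: "u \<in> V" "v \<in> V" using uv_tight domD by (auto simp: tight_def)
    consider "c u = b" | "c v = b" | "c u \<noteq> b" "c u = c v" by auto
    then show ?thesis
    proof cases
      case 1
      then show ?thesis using uv uv_tight by (intro bexI[of _ u]) (auto simp: star_def)
    next
      case 2
      then show ?thesis using uv uv_tight tight_sym by (intro bexI[of _ v]) (auto simp: star_def)
    next
      case 3
      then obtain w where "w \<in> V" "tight u w" "tight v w" "c w = b"
        using c[of u v] uv uv_tight by auto
      then show ?thesis using tight_sym by (intro bexI[of _ w]) (auto simp: star_def)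
    qed
  qed
  have "card {x \<in> V. c x = True} + card {x \<in> V. c x = False} = card V"
    using finite_V by (subst card_Un_disjoint[symmetric]) (auto intro!: arg_cong[where f = card])
  then have "2 * card {x \<in> V. c x = True} \<le> card V \<or> 2 * card {x \<in> V. c x = False} \<le> card V"
    by linarith
  then obtain b where "2 * card {x \<in> V. c x = b} \<le> card V" by blast
  then show ?thesis using that[of "{x \<in> V. c x = b}"] cover by blast
qed

section \<open>Counting the cliques\<close>

lemma ecc_le: "2 * ecc V E \<le> 3 * card V"
proof -
  obtain S where S: "S \<subseteq> V" "2 * card S \<le> card V"
    and cover: "\<And>u v. tight u v \<Longrightarrow> \<exists>s\<in>S. {u, v} \<subseteq> star s"
    using ex_star_cover by metis
  have fin: "finite S" using S finite_V finite_subset by blast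
  let ?N = "(\<lambda>x. non_neighbours x \<union> tops x) ` V"
  let ?C = "?N \<union> star ` S"
  have sub: "K \<subseteq> V \<and> clique K E" if "K \<in> ?C" for K
    using that S(1) clique_star clique_non_neighbours_tops
    by (auto simp: star_def tight_def tops_def non_neighbours_def dest: domD)
  moreover have "\<exists>K\<in>?C. e \<subseteq> K" if e: "e \<in> E" for e
  proof -
    have "e \<in> [V]\<^bsup>2\<^esup>" using e edges by blast
    then obtain u v where uv: "e = {u, v}" by (auto simp: nsets_2_eq)
    then show ?thesis
      using edge_covered[of u v] cover[of u v] e by (cases "tight u v") blast+
  qed
  ultimately have "edge_clique_cover V E ?C"
    using finite_V fin by (auto simp: edge_clique_cover_def)
  then have "ecc V E \<le> card ?C"
    unfolding ecc_def by (intro Least_le) blast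
  also have "\<dots> \<le> card ?N + card (star ` S)" by (rule card_Un_le)
  also have "\<dots> \<le> card V + card S"
    using finite_V fin by (intro add_mono card_image_le)
  finally show ?thesis using S(2) by linarith
qed

end

section \<open>From the independence number to the absence of independent triples\<close>

lemma independent_set_card_le:
  assumes "finite V" "S \<subseteq> V" "indep S E"
  shows "card S \<le> independence_number V E"
  unfolding independence_number_def using assms by (intro Max_ge) auto

theorem theorem8:
  fixes V :: "'a set" and E :: "'a set set"
  assumes "finite V" and "E \<subseteq> [V]\<^bsup>2\<^esup>"
    and "independence_number V E = 2"
    and "\<not> (\<exists>k u. supercycle V E k u)"
    and "\<not> (\<exists>x0 x1 x2 x3 x4. incompatible_double_top V E x0 x1 x2 x3 x4)"
  shows "real (ecc V E) \<le> 3 / 2 * real (card V)"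
proof -
  interpret two_independent_graph V E
  proof
    fix x y z assume xyz: "x \<in> V" "y \<in> V" "z \<in> V" "distinct [x, y, z]"
    show "{x, y} \<in> E \<or> {x, z} \<in> E \<or> {y, z} \<in> E"
    proof (rule ccontr)
      assume "\<not> ?thesis"
      then have "indep {x, y, z} E"
        by (auto simp: indep_def insert_commute)
      then show False
        using independent_set_card_le[of V "{x, y, z}" E] assms(1,3) xyz by simp
    qed
  qed (use assms in auto)
  show ?thesis using ecc_le by linarith
qed

end
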